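(* Let $A:\mathbb R_+\to\mathbb R^{M\times M}$ be continuous with $A(0)=0$, and let $Y$ be the unique solution of the linear matrix ODE $Y'(\tau)=A(\tau)Y(\tau)$, $Y(0)=I_M$. Suppose $Y''(\tau)=B(\tau)Y(\tau)$, where $B(\tau)$ is positive semidefinite for all $\tau\ge0$. Then $A(\tau)$ is positive semidefinite for all $\tau\ge0$.
   Context: A real square matrix $C$ is called positive semidefinite if $b^\top Cb\ge0$ for all vectors $b$; symmetry is not required. *)

theory Defs
  imports "HOL-Analysis.Analysis"
begin

text \<open>A real square matrix C is positive semidefinite if b^T C b \<ge> 0 for all b
  (symmetry not required).\<close>
definition psd :: "real^'m^'m \<Rightarrow> bool" where
  "psd C \<longleftrightarrow> (\<forall>b :: real^'m. 0 \<le> b \<bullet> (C *v b))"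

end

theory Submission
  imports Defs
begin

text \<open>For a fixed vector \<open>c\<close> put \<open>y = Y c\<close>. Then \<open>y' = A y\<close> and \<open>y'' = B y\<close>, so
  \<open>(y \<bullet> y')' = |y'|\<^sup>2 + y \<bullet> B y \<ge> 0\<close>: the quantity \<open>y \<bullet> A y\<close> is nondecreasing, and it
  vanishes at \<open>0\<close> because \<open>A 0 = 0\<close>. A Gronwall estimate shows that \<open>Y \<tau>\<close> stays invertible,
  so \<open>y \<tau>\<close> runs through all vectors as \<open>c\<close> does, which gives \<open>b \<bullet> A \<tau> b \<ge> 0\<close>.\<close>

lemma bounded_bilinear_matrix_vector_mult:
  "bounded_bilinear ((*v) :: real^'n^'m \<Rightarrow> real^'n \<Rightarrow> real^'m)"
proof -
  have "linear (\<lambda>M::real^'n^'m. M *v x)" for x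
    by (rule linearI)
      (auto simp: vec_eq_iff matrix_vector_mult_def sum.distrib algebra_simps sum_distrib_left)
  then show ?thesis
    by (simp add: bilinear_conv_bounded_bilinear[symmetric] bilinear_def matrix_vector_mul_linear)
qed

lemma has_vector_derivative_matrix_vector_mult:
  fixes Y :: "real \<Rightarrow> real^'n^'m"
  assumes "(Y has_vector_derivative Y') F"
  shows "((\<lambda>s. Y s *v c) has_vector_derivative Y' *v c) F"
  using bounded_linear.has_vector_derivative
    [OF bounded_bilinear.bounded_linear_left[OF bounded_bilinear_matrix_vector_mult] assms] .

lemma continuous_on_compact_matrix_vector_bound:
  fixes A :: "'a::topological_space \<Rightarrow> real^'n^'m"
  assumes "compact S" and "continuous_on S A"
  obtains L where "\<And>s x. s \<in> S \<Longrightarrow> norm (A s *v x) \<le> L * norm x"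
proof -
  obtain K where K: "\<And>s. s \<in> S \<Longrightarrow> norm (A s) \<le> K"
    using compact_imp_bounded[OF compact_continuous_image[OF assms(2,1)]]
    by (auto simp: bounded_iff)
  obtain K' where K': "K' > 0" "\<And>(M::real^'n^'m) x. norm (M *v x) \<le> norm M * norm x * K'"
    using bounded_bilinear.pos_bounded[OF bounded_bilinear_matrix_vector_mult] by blast
  have "norm (A s *v x) \<le> (K * K') * norm x" if "s \<in> S" for s x
  proof -
    have "norm (A s *v x) \<le> norm (A s) * norm x * K'" by (rule K'(2))
    also have "\<dots> \<le> K * norm x * K'"
      using K[OF that] K'(1) by (intro mult_right_mono) auto
    finally show ?thesis by (simp add: algebra_simps)
  qed
  then show ?thesis by (rule that)
qed

lemma DERIV_within_nonneg_imp_nondecreasing: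
  fixes f f' :: "real \<Rightarrow> real"
  assumes "a \<le> b"
    and deriv: "\<And>x. x \<in> {a..b} \<Longrightarrow> (f has_real_derivative f' x) (at x within {a..b})"
    and nonneg: "\<And>x. x \<in> {a..b} \<Longrightarrow> 0 \<le> f' x"
  shows "f a \<le> f b"
proof (rule DERIV_nonneg_imp_increasing_open[OF \<open>a \<le> b\<close>])
  fix x assume "a < x" "x < b"
  then show "\<exists>y. (f has_real_derivative y) (at x) \<and> 0 \<le> y"
    using deriv[of x] nonneg[of x] by (auto simp: at_within_Icc_at)
next
  show "continuous_on {a..b} f"
    using deriv DERIV_continuous continuous_on_eq_continuous_within by blast
qed

lemma linear_ode_vanishing_imp_vanishing_initial:
  fixes A :: "real \<Rightarrow> real^'n^'n" and y :: "real \<Rightarrow> real^'n"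
  assumes "a \<le> b" and "continuous_on {a..b} A"
    and ode: "\<And>s. s \<in> {a..b} \<Longrightarrow> (y has_vector_derivative A s *v y s) (at s within {a..b})"
    and "y b = 0"
  shows "y a = 0"
proof -
  obtain L where L: "\<And>s x. s \<in> {a..b} \<Longrightarrow> norm (A s *v x) \<le> L * norm x"
    using continuous_on_compact_matrix_vector_bound[OF compact_Icc assms(2)] by blast
  \<comment> \<open>Since \<open>|(|y|\<^sup>2)'| \<le> 2L|y|\<^sup>2\<close>, the weight makes \<open>h\<close> nondecreasing.\<close>
  define h where "h s = (y s \<bullet> y s) * exp (2 * L * s)" for s
  define h' where "h' s = (2 * (y s \<bullet> (A s *v y s)) + 2 * L * (y s \<bullet> y s)) * exp (2 * L * s)" for s
  have "h a \<le> h b"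
  proof (rule DERIV_within_nonneg_imp_nondecreasing[OF \<open>a \<le> b\<close>])
    fix s assume s: "s \<in> {a..b}"
    have "((\<lambda>s. y s \<bullet> y s) has_real_derivative 2 * (y s \<bullet> (A s *v y s))) (at s within {a..b})"
      using bounded_bilinear.has_vector_derivative[OF bounded_bilinear_inner ode[OF s] ode[OF s]]
      by (simp add: has_real_derivative_iff_has_vector_derivative inner_commute)
    then show "(h has_real_derivative h' s) (at s within {a..b})"
      unfolding h_def h'_def
      by (auto intro!: derivative_eq_intros simp: algebra_simps)
    have "\<bar>y s \<bullet> (A s *v y s)\<bar> \<le> norm (y s) * norm (A s *v y s)"
      by (rule Cauchy_Schwarz_ineq2)
    also have "\<dots> \<le> norm (y s) * (L * norm (y s))"
      using L[OF s] by (simp add: mult_left_mono)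
    also have "\<dots> = L * (y s \<bullet> y s)"
      by (simp add: power2_norm_eq_inner[symmetric] power2_eq_square)
    finally show "0 \<le> h' s" unfolding h'_def by simp
  qed
  then have "y a \<bullet> y a * exp (2 * L * a) \<le> 0"
    using \<open>y b = 0\<close> by (simp add: h_def)
  then have "y a \<bullet> y a \<le> 0"
    by (simp add: mult_le_0_iff)
  then show "y a = 0" by (metis inner_gt_zero_iff not_le)
qed

lemma linear_ode_fundamental_matrix_invertible:
  fixes A Y :: "real \<Rightarrow> real^'n^'n"
  assumes "a \<le> b" and "continuous_on {a..b} A"
    and ode: "\<And>s. s \<in> {a..b} \<Longrightarrow> (Y has_vector_derivative A s ** Y s) (at s within {a..b})"
    and "invertible (Y a)"
  shows "invertible (Y b)"
  unfolding invertible_left_inverse matrix_left_invertible_ker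
proof (intro allI impI)
  fix c assume "Y b *v c = 0"
  have "((\<lambda>s. Y s *v c) has_vector_derivative A s *v (Y s *v c)) (at s within {a..b})"
    if "s \<in> {a..b}" for s
    using has_vector_derivative_matrix_vector_mult[OF ode[OF that]]
    by (simp add: matrix_vector_mul_assoc)
  then have "Y a *v c = 0"
    using linear_ode_vanishing_imp_vanishing_initial[OF assms(1,2), of "\<lambda>s. Y s *v c"]
      \<open>Y b *v c = 0\<close> by blast
  then show "c = 0"
    using \<open>invertible (Y a)\<close> by (auto simp: invertible_left_inverse matrix_left_invertible_ker)
qed

lemma psd_second_order_ode_inner_nondecreasing:
  fixes y z :: "real \<Rightarrow> real^'n" and B :: "real \<Rightarrow> real^'n^'n"
  assumes "a \<le> b"
    and y': "\<And>s. s \<in> {a..b} \<Longrightarrow> (y has_vector_derivative z s) (at s within {a..b})"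
    and z': "\<And>s. s \<in> {a..b} \<Longrightarrow> (z has_vector_derivative B s *v y s) (at s within {a..b})"
    and B_psd: "\<And>s. s \<in> {a..b} \<Longrightarrow> psd (B s)"
  shows "y a \<bullet> z a \<le> y b \<bullet> z b"
proof (rule DERIV_within_nonneg_imp_nondecreasing[OF \<open>a \<le> b\<close>])
  fix s assume s: "s \<in> {a..b}"
  show "((\<lambda>s. y s \<bullet> z s) has_real_derivative y s \<bullet> (B s *v y s) + z s \<bullet> z s) (at s within {a..b})"
    using bounded_bilinear.has_vector_derivative[OF bounded_bilinear_inner y'[OF s] z'[OF s]]
    by (simp add: has_real_derivative_iff_has_vector_derivative)
  show "0 \<le> y s \<bullet> (B s *v y s) + z s \<bullet> z s"
    using B_psd[OF s] by (simp add: psd_def add_nonneg_nonneg)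
qed

theorem lemma7p5:
  fixes A B Y :: "real \<Rightarrow> real^'m^'m"
  assumes A_cont: "continuous_on {0..} A"
    and A0: "A 0 = 0"
    and Y0: "Y 0 = mat 1"
    and Y_ode: "\<forall>t\<ge>0. (Y has_vector_derivative (A t ** Y t)) (at t within {0..})"
    and Y2: "\<forall>t\<ge>0. ((\<lambda>s. A s ** Y s) has_vector_derivative (B t ** Y t)) (at t within {0..})"
    and B_psd: "\<forall>t\<ge>0. psd (B t)"
  shows "\<forall>t\<ge>0. psd (A t)"
proof (intro allI impI)
  fix t :: real assume "0 \<le> t"
  have Y': "(Y has_vector_derivative A s ** Y s) (at s within {0..t})"
    and AY': "((\<lambda>s. A s ** Y s) has_vector_derivative B s ** Y s) (at s within {0..t})"
    if "s \<in> {0..t}" for s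
    using Y_ode Y2 that by (auto intro: has_vector_derivative_within_subset)
  have "invertible (Y t)"
    using linear_ode_fundamental_matrix_invertible[OF \<open>0 \<le> t\<close> _ Y'] Y0
      continuous_on_subset[OF A_cont] by (auto simp: invertible_def)
  then obtain C where C: "Y t ** C = mat 1"
    by (auto simp: invertible_right_inverse)
  show "psd (A t)" unfolding psd_def
  proof
    fix b :: "real^'m"
    define c where "c = C *v b"
    have "(Y 0 *v c) \<bullet> ((A 0 ** Y 0) *v c) \<le> (Y t *v c) \<bullet> ((A t ** Y t) *v c)"
      using \<open>0 \<le> t\<close> has_vector_derivative_matrix_vector_mult[OF Y'] B_psd
        has_vector_derivative_matrix_vector_mult[OF AY']
      by (intro psd_second_order_ode_inner_nondecreasing[where B = B])
        (auto simp: matrix_vector_mul_assoc)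
    moreover have "Y t *v c = b"
      using C by (simp add: c_def matrix_vector_mul_assoc)
    ultimately show "0 \<le> b \<bullet> (A t *v b)"
      using A0 by (simp add: matrix_vector_mul_assoc[symmetric])
  qed
qed

end
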